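(* Let $p$ be a prime. For each integer $k\geq 1$ let $f_k(x,y)\in\mathbb{Q}(y)[x]$ be such that for every $z\in\mathbb{C}_p$ with $|z-1|_p\geq 1$ the map $$\mu_{k,z}(a+(p^N)) = p^{N(k-1)}\, z^a\, f_k(a/p^N, z^{p^N}),\qquad N\geq 0,\ 0\leq a\leq p^N-1,$$ (all values $f_k(a/p^N,z^{p^N})$ being defined) extends to a $p$-adic distribution on $\mathbb{Z}_p$, and suppose that $f_k(x,y)$ and its partial derivatives with respect to $x$ are defined at $(0,0)$. Let $h(k)\in\mathbb{Q}$ be the constant such that $y f_k(x+1,y)-f_k(x,y)=h(k)x^{k-1}$, and assume $h(1)\neq 0$. Fix $z\in\mathbb{C}_p$ with $|z-1|_p\geq 1$ and write $\mu_k=\mu_{k,z}$. Let $r$ and $k\geq 1$ be integers. Then: i) if $r\geq 0$, $\displaystyle\int_{\mathbb{Z}_p} x^r\, d\mu_{k} = \frac{h(k)}{h(1)}\int_{\mathbb{Z}_p} x^{r+k-1}\, d\mu_{1}$; ii) for every integer $r$, $\displaystyle\int_{\mathbb{Z}_p^*} x^r\, d\mu_{k} = \frac{h(k)}{h(1)}\int_{\mathbb{Z}_p^*} x^{r+k-1}\, d\mu_{1}$.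
   Context: $\mathbb{C}_p$ is the completion of a fixed algebraic closure of $\mathbb{Q}_p$, with norm normalized by $|p|_p=1/p$. $(p^N)=p^N\mathbb{Z}_p$. A $p$-adic distribution on $\mathbb{Z}_p$ is a finitely additive $\mathbb{C}_p$-valued function on the compact open subsets of $\mathbb{Z}_p$; it is a measure if bounded. Under the stated hypotheses a constant $h(k)$ as described always exists and each $\mu_{k,z}$ is a measure. For a measure $\mu$ and continuous $g$, $\int_{\mathbb{Z}_p} g\,d\mu=\lim_{N\to\infty}\sum_{a=0}^{p^N-1} g(a)\mu(a+(p^N))$, and $\int_{\mathbb{Z}_p^*}g\,d\mu$ is the analogous limit with the sum restricted to $a$ with $p\nmid a$. Convention $0^0=1$. *)

theory Defs
  imports "HOL-Analysis.Analysis" "HOL-Computational_Algebra.Computational_Algebra"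
    "HOL-Computational_Algebra.Field_as_Ring"
begin

text \<open>
  The field \<open>\<complex>\<^sub>p\<close> is an arbitrary type of sort \<open>{field_char_0, complete_space}\<close>
  satisfying the predicate \<open>padic_complex_field\<close> below. The library constant \<open>norm\<close> is
  constrained to real vector spaces, and the norm is therefore rendered as the distance to 0.

  In a complete field whose norm is multiplicative, ultrametric and normalised at \<open>p\<close>, the norm
  restricts to the \<open>p\<close>-adic one on the rationals, so their closure is the completion
  \<open>\<rat>\<^sub>p\<close>.
\<close>

definition pnorm :: "'a::{field_char_0, complete_space} \<Rightarrow> real" where
  "pnorm x = dist x 0"

definition padic_numbers :: "'a::{field_char_0, complete_space} set" where
  "padic_numbers = closure (range of_rat)"

definition padic_integers :: "'a::{field_char_0, complete_space} set" where
  "padic_integers = {x \<in> padic_numbers. pnorm x \<le> 1}"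

definition padic_algebraic :: "'a::{field_char_0, complete_space} set" where
  "padic_algebraic =
     {x. \<exists>q. q \<noteq> 0 \<and> (\<forall>i. coeff q i \<in> padic_numbers) \<and> poly q x = 0}"

text \<open>
  The last two conjuncts say that the elements algebraic over \<open>\<rat>\<^sub>p\<close> form an algebraically
  closed field, i.e. an algebraic closure of \<open>\<rat>\<^sub>p\<close>, and that the (complete) ambient field is
  its completion. Positive definiteness of the norm and completeness are part of the sort.
\<close>

definition padic_complex_field ::
    "nat \<Rightarrow> 'a::{field_char_0, complete_space} itself \<Rightarrow> bool" where
  "padic_complex_field p (T :: 'a itself) \<longleftrightarrow>
     (\<forall>x y :: 'a. dist x y = pnorm (x - y)) \<and>
     (\<forall>x y :: 'a. pnorm (x * y) = pnorm x * pnorm y) \<and>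
     (\<forall>x y :: 'a. pnorm (x + y) \<le> max (pnorm x) (pnorm y)) \<and>
     pnorm (of_nat p :: 'a) = 1 / real p \<and>
     (\<forall>q :: 'a poly. (\<forall>i. coeff q i \<in> padic_algebraic) \<and> degree q > 0 \<longrightarrow>
        (\<exists>x \<in> padic_algebraic. poly q x = 0)) \<and>
     closure (padic_algebraic :: 'a set) = UNIV"

definition padic_disc ::
    "nat \<Rightarrow> nat \<Rightarrow> nat \<Rightarrow> 'a::{field_char_0, complete_space} set" where
  "padic_disc p a N = (\<lambda>x. of_nat a + of_nat p ^ N * x) ` padic_integers"

definition padic_compact_open :: "'a::{field_char_0, complete_space} set \<Rightarrow> bool" where
  "padic_compact_open U \<longleftrightarrow> compact U \<and> openin (top_of_set padic_integers) U"

definition padic_distribution ::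
    "('a::{field_char_0, complete_space} set \<Rightarrow> 'a) \<Rightarrow> bool" where
  "padic_distribution \<mu> \<longleftrightarrow>
     (\<forall>U V. padic_compact_open U \<and> padic_compact_open V \<and> U \<inter> V = {} \<longrightarrow>
        \<mu> (U \<union> V) = \<mu> U + \<mu> V)"

definition padic_integral ::
    "nat \<Rightarrow> ('a::{field_char_0, complete_space} set \<Rightarrow> 'a) \<Rightarrow> ('a \<Rightarrow> 'a) \<Rightarrow> 'a" where
  "padic_integral p \<mu> g =
     lim (\<lambda>N. \<Sum>a<p ^ N. g (of_nat a) * \<mu> (padic_disc p a N))"

definition padic_unit_integral ::
    "nat \<Rightarrow> ('a::{field_char_0, complete_space} set \<Rightarrow> 'a) \<Rightarrow> ('a \<Rightarrow> 'a) \<Rightarrow> 'a" where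
  "padic_unit_integral p \<mu> g =
     lim (\<lambda>N. \<Sum>a | a < p ^ N \<and> \<not> p dvd a. g (of_nat a) * \<mu> (padic_disc p a N))"

text \<open>
  Elements of \<open>\<rat>(y)\<close> have type \<open>rat poly fract\<close>; \<open>quot_of_fract\<close> yields numerator and
  denominator in lowest terms. Elements of \<open>\<rat>(y)[x]\<close> have type \<open>rat poly fract poly\<close>, with
  \<open>x\<close> the outer variable; denominators involve \<open>y\<close> only, so such a function is defined at
  \<open>(x, y)\<close> iff all its coefficients are defined at \<open>y\<close>.
\<close>

definition ratfun_defined :: "rat poly fract \<Rightarrow> 'a::field_char_0 \<Rightarrow> bool" where
  "ratfun_defined c y \<longleftrightarrow> poly (map_poly of_rat (snd (quot_of_fract c))) y \<noteq> 0"

definition ratfun_eval :: "rat poly fract \<Rightarrow> 'a::field_char_0 \<Rightarrow> 'a" where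
  "ratfun_eval c y =
     poly (map_poly of_rat (fst (quot_of_fract c))) y /
     poly (map_poly of_rat (snd (quot_of_fract c))) y"

definition xpoly_defined :: "rat poly fract poly \<Rightarrow> 'a::field_char_0 \<Rightarrow> 'a \<Rightarrow> bool" where
  "xpoly_defined f x y \<longleftrightarrow> (\<forall>i. ratfun_defined (coeff f i) y)"

definition xpoly_eval :: "rat poly fract poly \<Rightarrow> 'a::field_char_0 \<Rightarrow> 'a \<Rightarrow> 'a" where
  "xpoly_eval f x y = poly (map_poly (\<lambda>c. ratfun_eval c y) f) x"

end

theory Submission
  imports Defs
begin

text \<open>
  Write \<open>\<kappa>(a + (p\<^sup>N)) = z\<^sup>a / (z^(p\<^sup>N) - 1)\<close>. Both parts follow from one formula: for every
  \<open>j \<ge> 1\<close> the integral of \<open>x\<^sup>r\<close> against \<open>\<mu>\<^sub>j\<close> is \<open>h(j)\<close> times the integral of \<open>x^(r+j-1)\<close> against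
  \<open>\<kappa>\<close>, over all of \<open>\<int>\<^sub>p\<close> if \<open>r \<ge> 0\<close> and over the units for every \<open>r\<close>. Comparing \<open>j = k\<close> with
  \<open>j = 1\<close> and dividing by \<open>h(1)\<close> gives the proposition.

  The formula holds because \<open>\<mu>\<^sub>j\<close> differs from \<open>h(j) x^(j-1) \<kappa>\<close> by an error that tends to 0
  uniformly. Let \<open>y = z^(p\<^sup>N)\<close> and let \<open>e\<^sub>i\<close> be the coefficient of \<open>x\<^sup>i\<close> in \<open>f\<^sub>j(x, y)\<close>. The
  difference equation \<open>y f\<^sub>j(x+1, y) - f\<^sub>j(x, y) = h(j) x^(j-1)\<close> is a triangular linear system
  for the \<open>e\<^sub>i\<close> with \<open>y - 1\<close> on the diagonal. Hence \<open>f\<^sub>j\<close> has degree at most \<open>j - 1\<close> in \<open>x\<close>, the top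
  coefficient is \<open>h(j) / (y - 1)\<close>, and, as \<open>|y| \<le> |y - 1|\<close>, every coefficient satisfies
  \<open>|e\<^sub>i| \<le> |h(j)| / |y - 1|\<close> (lemma \<open>shift_recurrence_bounds\<close>). In
  \<open>p^(N(j-1)) z\<^sup>a f\<^sub>j(a/p\<^sup>N, y)\<close> the top coefficient contributes \<open>h(j) a^(j-1) \<kappa>(a + (p\<^sup>N))\<close>, and all
  other terms carry at least one factor \<open>p\<^sup>N\<close> (lemma \<open>distribution_leading_term\<close>).

  The hypothesis \<open>|z - 1| \<ge> 1\<close> enters through \<open>|z^(p\<^sup>N) - 1| = |z - 1|^(p\<^sup>N)\<close>, which bounds
  \<open>z\<^sup>a / (z^(p\<^sup>N) - 1)\<close> by 1 for \<open>a \<le> p\<^sup>N\<close>, so that \<open>\<kappa>\<close> is a measure. The Riemann sums of a Lipschitz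
  function against \<open>\<kappa>\<close> therefore converge (lemma \<open>riemann_sums_converge\<close>), and a uniformly
  small change of the weights leaves the limit unchanged (lemma \<open>lim_scaled_eqI\<close>).
\<close>

section \<open>Evaluating rational functions\<close>

lemma poly_of_rat_add:
  "poly (map_poly of_rat (P + Q)) (y :: 'a::field_char_0) =
     poly (map_poly of_rat P) y + poly (map_poly of_rat Q) y"
proof -
  have "map_poly of_rat (P + Q) = (map_poly of_rat P + map_poly of_rat Q :: 'a poly)"
    by (rule poly_eqI) (simp add: coeff_map_poly of_rat_add)
  then show ?thesis by simp
qed

lemma poly_of_rat_mult:
  "poly (map_poly of_rat (P * Q)) (y :: 'a::field_char_0) =
     poly (map_poly of_rat P) y * poly (map_poly of_rat Q) y"
proof -
  have "map_poly of_rat (P * Q) = (map_poly of_rat P * map_poly of_rat Q :: 'a poly)"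
    by (rule poly_eqI) (simp add: coeff_map_poly coeff_mult of_rat_sum of_rat_mult)
  then show ?thesis by simp
qed

lemma quot_of_fract_cross:
  "c * to_fract (snd (quot_of_fract c)) = to_fract (fst (quot_of_fract c))"
proof -
  have "c = to_fract (fst (quot_of_fract c)) / to_fract (snd (quot_of_fract c))"
    unfolding Fract_conv_to_fract [symmetric] by simp
  then show ?thesis by (metis nonzero_eq_divide_eq snd_quot_of_fract_nonzero to_fract_eq_0_iff)
qed

text \<open>
  The reduced denominator divides the denominator of any other representation of \<open>c\<close>, so a
  representation that makes sense at \<open>y\<close> already determines the value. This makes evaluation
  a ring homomorphism on the functions defined at \<open>y\<close>.
\<close>

lemma ratfun_eval_eqI:
  fixes y :: "'a::field_char_0"
  assumes c: "c * to_fract Q = to_fract P" and Q: "poly (map_poly of_rat Q) y \<noteq> 0"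
  shows "ratfun_defined c y"
    and "ratfun_eval c y = poly (map_poly of_rat P) y / poly (map_poly of_rat Q) y"
proof -
  define n d where "n = fst (quot_of_fract c)" and "d = snd (quot_of_fract c)"
  have "to_fract (n * Q) = (c * to_fract d) * to_fract Q"
    by (simp add: n_def d_def quot_of_fract_cross)
  also have "\<dots> = to_fract (P * d)"
    by (simp add: mult.commute mult.left_commute flip: c)
  finally have "to_fract (n * Q) = to_fract (P * d)" .
  then have eq: "n * Q = P * d" by (simp only: to_fract_eq_iff)
  have "coprime d n"
    unfolding n_def d_def using coprime_quot_of_fract [of c] by (simp add: coprime_commute)
  moreover have "d dvd n * Q" by (simp add: eq)
  ultimately have "d dvd Q" by (simp add: coprime_dvd_mult_right_iff)
  then have d: "poly (map_poly of_rat d) y \<noteq> 0"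
    using Q by (auto simp: poly_of_rat_mult elim!: dvdE)
  then show "ratfun_defined c y" by (simp add: ratfun_defined_def d_def)
  have "poly (map_poly of_rat n) y * poly (map_poly of_rat Q) y =
      poly (map_poly of_rat P) y * poly (map_poly of_rat d) y"
    using eq by (metis poly_of_rat_mult)
  then show "ratfun_eval c y = poly (map_poly of_rat P) y / poly (map_poly of_rat Q) y"
    using d Q unfolding ratfun_eval_def n_def [symmetric] d_def [symmetric]
    by (simp add: field_simps)
qed

lemma ratfun_eval_to_fract:
  "ratfun_defined (to_fract P) y" "ratfun_eval (to_fract P) y = poly (map_poly of_rat P) y"
  by (simp_all add: ratfun_defined_def ratfun_eval_def)

lemma ratfun_eval_0 [simp]: "ratfun_eval 0 y = 0"
  by (simp add: ratfun_eval_def)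

lemma ratfun_eval_add:
  fixes y :: "'a::field_char_0"
  assumes "ratfun_defined c y" "ratfun_defined d y"
  shows "ratfun_defined (c + d) y" "ratfun_eval (c + d) y = ratfun_eval c y + ratfun_eval d y"
proof -
  let ?n = "\<lambda>c. fst (quot_of_fract c)" and ?d = "\<lambda>c. snd (quot_of_fract c)"
  have "(c + d) * to_fract (?d c * ?d d) =
      (c * to_fract (?d c)) * to_fract (?d d) + (d * to_fract (?d d)) * to_fract (?d c)"
    by (simp add: algebra_simps)
  also have "\<dots> = to_fract (?n c * ?d d + ?n d * ?d c)"
    by (simp add: quot_of_fract_cross)
  finally have *: "(c + d) * to_fract (?d c * ?d d) = to_fract (?n c * ?d d + ?n d * ?d c)" .
  have "poly (map_poly of_rat (?d c * ?d d)) y \<noteq> 0"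
    using assms by (simp add: ratfun_defined_def poly_of_rat_mult)
  note ratfun_eval_eqI [OF * this]
  then show "ratfun_defined (c + d) y" "ratfun_eval (c + d) y = ratfun_eval c y + ratfun_eval d y"
    using assms
    by (simp_all add: ratfun_defined_def ratfun_eval_def poly_of_rat_mult poly_of_rat_add field_simps)
qed

lemma ratfun_eval_mult:
  fixes y :: "'a::field_char_0"
  assumes "ratfun_defined c y" "ratfun_defined d y"
  shows "ratfun_defined (c * d) y" "ratfun_eval (c * d) y = ratfun_eval c y * ratfun_eval d y"
proof -
  let ?n = "\<lambda>c. fst (quot_of_fract c)" and ?d = "\<lambda>c. snd (quot_of_fract c)"
  have "(c * d) * to_fract (?d c * ?d d) = (c * to_fract (?d c)) * (d * to_fract (?d d))"
    by (simp add: algebra_simps)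
  also have "\<dots> = to_fract (?n c * ?n d)"
    by (simp add: quot_of_fract_cross)
  finally have *: "(c * d) * to_fract (?d c * ?d d) = to_fract (?n c * ?n d)" .
  have "poly (map_poly of_rat (?d c * ?d d)) y \<noteq> 0"
    using assms by (simp add: ratfun_defined_def poly_of_rat_mult)
  note ratfun_eval_eqI [OF * this]
  then show "ratfun_defined (c * d) y" "ratfun_eval (c * d) y = ratfun_eval c y * ratfun_eval d y"
    using assms by (simp_all add: ratfun_defined_def ratfun_eval_def poly_of_rat_mult)
qed

lemma ratfun_eval_of_nat:
  "ratfun_defined (of_nat n) y" "ratfun_eval (of_nat n) y = of_nat n"
proof -
  have "to_fract [:of_nat n:] = (of_nat n :: rat poly fract)"
  proof (induction n)
    case (Suc n)
    have "to_fract [:of_nat (Suc n):] = to_fract ([:1 :: rat:] + [:of_nat n:])" by simp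
    also have "\<dots> = 1 + to_fract [:of_nat n:]"
      by (simp only: to_fract_add flip: one_pCons) simp
    finally show ?case by (simp add: Suc.IH)
  qed simp
  then show "ratfun_defined (of_nat n) y" "ratfun_eval (of_nat n) y = of_nat n"
    using ratfun_eval_to_fract [of "[:of_nat n:]" y] by (simp_all add: map_poly_pCons)
qed

lemma ratfun_eval_sum:
  fixes y :: "'a::field_char_0"
  assumes "\<And>i. i \<in> A \<Longrightarrow> ratfun_defined (c i) y"
  shows "ratfun_defined (\<Sum>i\<in>A. c i) y"
    and "ratfun_eval (\<Sum>i\<in>A. c i) y = (\<Sum>i\<in>A. ratfun_eval (c i) y)"
proof -
  have "ratfun_defined (\<Sum>i\<in>A. c i) y \<and>
      ratfun_eval (\<Sum>i\<in>A. c i) y = (\<Sum>i\<in>A. ratfun_eval (c i) y)"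
    using assms
  proof (induction A rule: infinite_finite_induct)
    case (insert a A)
    then show ?case by (simp add: ratfun_eval_add)
  qed (simp_all add: ratfun_defined_def)
  then show "ratfun_defined (\<Sum>i\<in>A. c i) y"
    "ratfun_eval (\<Sum>i\<in>A. c i) y = (\<Sum>i\<in>A. ratfun_eval (c i) y)" by auto
qed

section \<open>The coefficients of a solution of the difference equation\<close>

lemma coeff_pcompose_shift:
  fixes F :: "'a::comm_ring_1 poly"
  assumes "degree F \<le> d"
  shows "coeff (F \<circ>\<^sub>p [:1, 1:]) i = (\<Sum>m\<le>d. of_nat (m choose i) * coeff F m)"
proof -
  have pow: "coeff ([:1, 1:] ^ m) i = (of_nat (m choose i) :: 'a)" for m
  proof (cases "i \<le> m")
    case False
    moreover have "degree ([:1, 1 :: 'a:] ^ m) \<le> m"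
      using degree_power_le [of "[:1, 1 :: 'a:]" m] by simp
    ultimately show ?thesis by (simp add: coeff_eq_0 binomial_eq_0)
  qed (simp add: coeff_linear_poly_power)
  have "F = (\<Sum>m\<le>d. monom (coeff F m) m)"
    using assms by (rule poly_as_sum_of_monoms' [symmetric])
  then have "F \<circ>\<^sub>p [:1, 1:] = (\<Sum>m\<le>d. monom (coeff F m) m \<circ>\<^sub>p [:1, 1:])"
    by (metis (no_types, lifting) pcompose_sum sum.cong)
  also have "\<dots> = (\<Sum>m\<le>d. smult (coeff F m) ([:1, 1:] ^ m))"
    by (simp add: pcompose_altdef map_poly_monom poly_monom)
  finally show ?thesis
    by (simp add: coeff_sum pow mult.commute)
qed

text \<open>
  Comparing coefficients of \<open>x\<^sup>i\<close> in the difference equation and evaluating at \<open>y\<close> turns it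
  into linear equations between elements of the field, where norms are available.
\<close>

lemma xpoly_eval_coeff_recurrence:
  fixes y :: "'a::field_char_0"
  assumes eq: "smult (to_fract [:0, 1:]) (F \<circ>\<^sub>p [:1, 1:]) - F = monom (to_fract [:c:]) n"
    and y: "xpoly_defined F x y"
    and d: "degree F \<le> d"
  shows "y * (\<Sum>m\<le>d. of_nat (m choose i) * ratfun_eval (coeff F m) y)
           = ratfun_eval (coeff F i) y + (if i = n then of_rat c else 0)"
proof -
  have def: "ratfun_defined (coeff F m) y" for m
    using y by (simp add: xpoly_defined_def)
  let ?S = "\<Sum>m\<le>d. of_nat (m choose i) * coeff F m"
  have S: "ratfun_defined ?S y"
    "ratfun_eval ?S y = (\<Sum>m\<le>d. of_nat (m choose i) * ratfun_eval (coeff F m) y)"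
    by (simp_all add: ratfun_eval_sum ratfun_eval_mult ratfun_eval_of_nat def)
  have "coeff (smult (to_fract [:0, 1:]) (F \<circ>\<^sub>p [:1, 1:]) - F) i =
      (if i = n then to_fract [:c:] else 0)"
    unfolding eq by simp
  then have "to_fract [:0, 1:] * ?S = coeff F i + to_fract (if i = n then [:c:] else 0)"
    by (auto simp: coeff_pcompose_shift [OF d] algebra_simps split: if_splits)
  then have "ratfun_eval (to_fract [:0, 1:] * ?S) y =
      ratfun_eval (coeff F i + to_fract (if i = n then [:c:] else 0)) y"
    by (rule arg_cong)
  then show ?thesis
    by (simp add: ratfun_eval_mult ratfun_eval_add ratfun_eval_to_fract S def map_poly_pCons
        split: if_splits)
qed

section \<open>Ultrametric norms\<close>

locale padic_norm =
  fixes p :: nat and T :: "'a::{field_char_0, complete_space} itself"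
  assumes prime_p: "prime p"
    and dist_pnorm: "dist (x :: 'a) y = pnorm (x - y)"
    and pnorm_mult: "pnorm (x * y :: 'a) = pnorm x * pnorm y"
    and pnorm_add_le: "pnorm (x + y :: 'a) \<le> max (pnorm x) (pnorm y)"
    and pnorm_p: "pnorm (of_nat p :: 'a) = 1 / real p"
begin

lemma pnorm_0 [simp]: "pnorm (0 :: 'a) = 0"
  by (simp add: pnorm_def)

lemma pnorm_eq_0_iff [simp]: "pnorm (x :: 'a) = 0 \<longleftrightarrow> x = 0"
  by (simp add: pnorm_def)

lemma pnorm_nonneg [simp]: "0 \<le> pnorm (x :: 'a)"
  by (simp add: pnorm_def)

lemma pnorm_1 [simp]: "pnorm (1 :: 'a) = 1"
  using pnorm_mult [of 1 1] by simp

lemma pnorm_minus [simp]: "pnorm (- x :: 'a) = pnorm x"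
  by (metis dist_commute dist_pnorm diff_0 diff_zero)

lemma pnorm_minus_commute: "pnorm (x - y :: 'a) = pnorm (y - x)"
  by (metis minus_diff_eq pnorm_minus)

lemma pnorm_power: "pnorm (x ^ n :: 'a) = pnorm x ^ n"
  by (induction n) (simp_all add: pnorm_mult)

lemma pnorm_divide: "pnorm (x / y :: 'a) = pnorm x / pnorm y"
proof (cases "y = 0")
  case False
  have "pnorm (x / y) * pnorm y = pnorm (x / y * y)" by (rule pnorm_mult [symmetric])
  then show ?thesis using False by (simp add: field_simps)
qed simp

lemma pnorm_inverse: "pnorm (inverse x :: 'a) = inverse (pnorm x)"
  using pnorm_divide [of 1 x] by (simp add: inverse_eq_divide)

lemma pnorm_add_leI: "pnorm x \<le> B \<Longrightarrow> pnorm y \<le> B \<Longrightarrow> pnorm (x + y :: 'a) \<le> B"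
  using pnorm_add_le [of x y] by simp

lemma pnorm_diff_leI: "pnorm x \<le> B \<Longrightarrow> pnorm y \<le> B \<Longrightarrow> pnorm (x - y :: 'a) \<le> B"
  using pnorm_add_leI [of x B "- y"] by simp

lemma pnorm_sum_leI:
  assumes "\<And>i. i \<in> A \<Longrightarrow> pnorm (c i :: 'a) \<le> B" and "0 \<le> B"
  shows "pnorm (\<Sum>i\<in>A. c i) \<le> B"
  using assms by (induction A rule: infinite_finite_induct) (simp_all add: pnorm_add_leI)

lemma pnorm_add_eq:
  assumes "pnorm (y :: 'a) < pnorm x"
  shows "pnorm (x + y) = pnorm x"
proof (rule antisym)
  show "pnorm (x + y) \<le> pnorm x" using assms by (simp add: pnorm_add_leI)
  have "pnorm x \<le> max (pnorm (x + y)) (pnorm y)"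
    using pnorm_add_le [of "x + y" "- y"] by simp
  then show "pnorm x \<le> pnorm (x + y)" using assms by simp
qed

lemma pnorm_le_pnorm_minus_1:
  assumes "pnorm (w - 1 :: 'a) \<ge> 1"
  shows "pnorm w \<le> pnorm (w - 1)"
  using pnorm_add_leI [of "w - 1" "pnorm (w - 1)" 1] assms by simp

lemma pnorm_of_nat_le_1: "pnorm (of_nat n :: 'a) \<le> 1"
  by (induction n) (simp_all add: pnorm_add_leI)

lemma pnorm_of_int_le_1: "pnorm (of_int m :: 'a) \<le> 1"
  by (cases m rule: int_cases2) (simp_all add: pnorm_of_nat_le_1)

lemma pnorm_of_int_le_power:
  assumes "int p ^ N dvd m"
  shows "pnorm (of_int m :: 'a) \<le> 1 / real p ^ N"
proof -
  obtain l where "m = int p ^ N * l" using assms by (elim dvdE)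
  then have "pnorm (of_int m :: 'a) = (1 / real p) ^ N * pnorm (of_int l :: 'a)"
    by (simp add: pnorm_mult pnorm_power pnorm_p)
  also have "\<dots> \<le> (1 / real p) ^ N * 1"
    by (intro mult_left_mono pnorm_of_int_le_1) simp
  finally show ?thesis by (simp add: power_one_over)
qed

lemma pnorm_of_nat_unit:
  assumes "\<not> p dvd a"
  shows "pnorm (of_nat a :: 'a) = 1"
proof -
  have "coprime (int a) (int p)"
    using prime_imp_coprime [OF prime_p assms] by (simp add: coprime_commute)
  then obtain u v where uv: "u * int a + v * int p = 1"
    by (metis bezout_int coprime_imp_gcd_eq_1)
  have "(of_int u * of_nat a + of_int v * of_nat p :: 'a) = of_int (u * int a + v * int p)"
    by simp
  also have "\<dots> = 1" by (simp only: uv of_int_1)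
  finally have "1 \<le> max (pnorm (of_int u * of_nat a :: 'a)) (pnorm (of_int v * of_nat p :: 'a))"
    using pnorm_add_le [of "of_int u * of_nat a" "of_int v * of_nat p"] by simp
  moreover have "pnorm (of_int v * of_nat p :: 'a) < 1"
  proof -
    have "pnorm (of_int v * of_nat p :: 'a) \<le> 1 * (1 / real p)"
      unfolding pnorm_mult pnorm_p by (intro mult_right_mono pnorm_of_int_le_1) simp
    also have "\<dots> < 1" using prime_gt_1_nat [OF prime_p] by simp
    finally show ?thesis .
  qed
  moreover have "pnorm (of_int u * of_nat a :: 'a) \<le> 1 * pnorm (of_nat a :: 'a)"
    unfolding pnorm_mult by (intro mult_right_mono pnorm_of_int_le_1) simp
  ultimately show ?thesis using pnorm_of_nat_le_1 [of a] by simp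
qed

text \<open>
  With \<open>u = w - 1\<close> the binomial expansion gives \<open>w\<^sup>p - 1 = u\<^sup>p + \<dots>\<close>, where the omitted terms have
  binomial coefficients divisible by \<open>p\<close> and powers of \<open>u\<close> below \<open>u\<^sup>p\<close>; as \<open>|u| \<ge> 1\<close>, the
  term \<open>u\<^sup>p\<close> strictly dominates them.
\<close>

lemma pnorm_prime_power_minus_1:
  assumes "pnorm (w - 1 :: 'a) \<ge> 1"
  shows "pnorm (w ^ p - 1) = pnorm (w - 1) ^ p"
proof -
  define u where "u = w - 1"
  have u: "pnorm u \<ge> 1" using assms by (simp add: u_def)
  have p: "p > 1" by (rule prime_gt_1_nat [OF prime_p])
  have "w ^ p = (u + 1) ^ p" by (simp add: u_def)
  also have "\<dots> = (\<Sum>i\<le>p. of_nat (p choose i) * u ^ i)" by (simp add: binomial_ring)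
  also have "{..p} = insert 0 (insert p {0<..<p})" using p by auto
  also have "(\<Sum>i\<in>\<dots>. of_nat (p choose i) * u ^ i) =
      1 + (u ^ p + (\<Sum>i\<in>{0<..<p}. of_nat (p choose i) * u ^ i))"
    using p by simp
  finally have eq: "w ^ p - 1 = u ^ p + (\<Sum>i\<in>{0<..<p}. of_nat (p choose i) * u ^ i)"
    by simp
  have "pnorm (\<Sum>i\<in>{0<..<p}. of_nat (p choose i) * u ^ i) \<le> 1 / real p * pnorm u ^ p"
  proof (rule pnorm_sum_leI)
    fix i assume i: "i \<in> {0<..<p}"
    have "p dvd (p choose i)" using i prime_p p by (intro dvd_choose_prime) auto
    then have "pnorm (of_nat (p choose i) :: 'a) \<le> 1 / real p"
      using pnorm_of_int_le_power [of 1 "int (p choose i)"] by simp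
    moreover have "pnorm u ^ i \<le> pnorm u ^ p" using u i by (intro power_increasing) auto
    ultimately show "pnorm (of_nat (p choose i) * u ^ i) \<le> 1 / real p * pnorm u ^ p"
      unfolding pnorm_mult pnorm_power by (intro mult_mono) auto
  qed simp
  also have "\<dots> < 1 * pnorm u ^ p"
    using p u by (intro mult_strict_right_mono) (auto simp: divide_simps)
  finally show ?thesis
    unfolding eq using pnorm_add_eq by (simp add: pnorm_power u_def)
qed

lemma pnorm_prime_power_power_minus_1:
  assumes "pnorm (w - 1 :: 'a) \<ge> 1"
  shows "pnorm (w ^ (p ^ N) - 1) = pnorm (w - 1) ^ (p ^ N)"
proof (induction N)
  case (Suc N)
  have "pnorm (w ^ (p ^ N) - 1) \<ge> 1" unfolding Suc.IH using assms by (rule one_le_power)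
  from pnorm_prime_power_minus_1 [OF this] show ?case
    by (simp add: Suc.IH mult.commute flip: power_mult)
qed simp

lemma pnorm_prime_power_power_minus_1_ge:
  assumes "pnorm (w - 1 :: 'a) \<ge> 1"
  shows "pnorm (w ^ (p ^ N) - 1) \<ge> 1"
  unfolding pnorm_prime_power_power_minus_1 [OF assms] using assms by (rule one_le_power)

lemma pnorm_power_le_prime_power_minus_1:
  assumes w: "pnorm (w - 1 :: 'a) \<ge> 1" and a: "a \<le> p ^ N"
  shows "pnorm (w ^ a) \<le> pnorm (w ^ (p ^ N) - 1)"
proof -
  have "pnorm w ^ a \<le> pnorm (w - 1) ^ a"
    using pnorm_le_pnorm_minus_1 [OF w] by (intro power_mono) auto
  also have "\<dots> \<le> pnorm (w - 1) ^ (p ^ N)" using w a by (rule power_increasing [rotated])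
  finally show ?thesis by (simp add: pnorm_power pnorm_prime_power_power_minus_1 [OF w])
qed

end

section \<open>Riemann sums\<close>

lemma sum_lessThan_mult:
  fixes F :: "nat \<Rightarrow> 'b::comm_monoid_add"
  shows "(\<Sum>b<m * n. F b) = (\<Sum>a<m. \<Sum>j<n. F (a + m * j))"
proof -
  have "(\<Sum>b<m * n. F b) = (\<Sum>j<n. sum F {j * m..<j * m + m})"
    using sum.nat_group [of F m n] by (simp add: mult.commute)
  also have "\<dots> = (\<Sum>j<n. \<Sum>a<m. F (a + m * j))"
  proof (rule sum.cong [OF refl])
    fix j
    show "sum F {j * m..<j * m + m} = (\<Sum>a<m. F (a + m * j))"
      using sum.shift_bounds_nat_ivl [of F 0 "j * m" m]
      by (simp add: atLeast0LessThan mult.commute add.commute)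
  qed
  also have "\<dots> = (\<Sum>a<m. \<Sum>j<n. F (a + m * j))" by (rule sum.swap)
  finally show ?thesis .
qed

context padic_norm
begin

text \<open>
  This is the Lipschitz condition with constant 1 on the naturals with their \<open>p\<close>-adic distance.
\<close>

definition lipschitz :: "(nat \<Rightarrow> 'a) \<Rightarrow> bool" where
  "lipschitz g \<longleftrightarrow> (\<forall>a j N. pnorm (g (a + p ^ N * j) - g a) \<le> 1 / real p ^ N)"

lemma tendsto_divide_prime_power: "(\<lambda>N. B / real p ^ N) \<longlonglongrightarrow> 0"
  using prime_gt_1_nat [OF prime_p]
  by (intro tendsto_divide_0 [OF tendsto_const] filterlim_realpow_sequentially_gt1) auto

text \<open>
  Splitting each disc of level \<open>N\<close> into \<open>p\<close> discs of level \<open>N + 1\<close> moves the sample points by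
  multiples of \<open>p\<^sup>N\<close>, so consecutive Riemann sums differ by at most \<open>B / p\<^sup>N\<close>. By the
  ultrametric inequality the same bound holds for all later sums, and they form a Cauchy
  sequence.
\<close>

lemma riemann_sums_converge:
  fixes g :: "nat \<Rightarrow> 'a" and m :: "nat \<Rightarrow> nat \<Rightarrow> 'a"
  assumes g: "lipschitz g"
    and additive: "\<And>N a. a < p ^ N \<Longrightarrow> m N a = (\<Sum>j<p. m (Suc N) (a + p ^ N * j))"
    and bounded: "\<And>N a. a < p ^ N \<Longrightarrow> pnorm (m N a) \<le> B"
  shows "convergent (\<lambda>N. \<Sum>a<p ^ N. g a * m N a)"
proof -
  let ?S = "\<lambda>N. \<Sum>a<p ^ N. g a * m N a"
  have p: "p > 1" by (rule prime_gt_1_nat [OF prime_p])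
  have "pnorm (m 0 0) \<le> B" by (rule bounded) simp
  then have B: "B \<ge> 0" using pnorm_nonneg [of "m 0 0"] by linarith
  have step: "pnorm (?S (Suc N) - ?S N) \<le> B / real p ^ N" for N
  proof -
    have "?S (Suc N) = (\<Sum>a<p ^ N. \<Sum>j<p. g (a + p ^ N * j) * m (Suc N) (a + p ^ N * j))"
      using sum_lessThan_mult [of _ "p ^ N" p] by (simp add: mult.commute)
    moreover have "?S N = (\<Sum>a<p ^ N. \<Sum>j<p. g a * m (Suc N) (a + p ^ N * j))"
      by (intro sum.cong refl) (simp add: additive sum_distrib_left)
    ultimately have "?S (Suc N) - ?S N =
        (\<Sum>a<p ^ N. \<Sum>j<p. (g (a + p ^ N * j) - g a) * m (Suc N) (a + p ^ N * j))"
      by (simp add: sum_subtractf left_diff_distrib)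
    also have "pnorm \<dots> \<le> 1 / real p ^ N * B"
    proof (intro pnorm_sum_leI)
      fix a j assume "a \<in> {..<p ^ N}" "j \<in> {..<p}"
      then have "p ^ N * Suc j \<le> p ^ N * p" "a < p ^ N" by (intro mult_le_mono2, auto)
      then have "a + p ^ N * j < p ^ Suc N" by (simp add: algebra_simps)
      then show "pnorm ((g (a + p ^ N * j) - g a) * m (Suc N) (a + p ^ N * j))
          \<le> 1 / real p ^ N * B"
        using g unfolding pnorm_mult lipschitz_def
        by (intro mult_mono bounded) auto
    qed (use B in auto)
    finally show ?thesis by simp
  qed
  have tail: "pnorm (?S (N + l) - ?S N) \<le> B / real p ^ N" for N l
  proof (induction l)
    case (Suc l)
    have "B / real p ^ (N + l) \<le> B / real p ^ N"
      using p B by (intro divide_left_mono power_increasing) auto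
    then have "pnorm (?S (Suc (N + l)) - ?S (N + l)) \<le> B / real p ^ N"
      using step [of "N + l"] by linarith
    from pnorm_add_leI [OF this Suc.IH] show ?case by simp
  qed (use B in simp)
  have "Cauchy ?S"
  proof (rule metric_CauchyI)
    fix e :: real assume "e > 0"
    then have "\<forall>\<^sub>F N in sequentially. B / real p ^ N < e" by (rule order_tendstoD [OF tendsto_divide_prime_power])
    then obtain M where M: "B / real p ^ M < e" by (auto simp: eventually_sequentially)
    have near: "pnorm (?S n - ?S M) \<le> B / real p ^ M" if "n \<ge> M" for n
      using tail [of M "n - M"] that by simp
    have "dist (?S n) (?S n') < e" if "n \<ge> M" "n' \<ge> M" for n n'
      using pnorm_diff_leI [OF near [OF that(1)] near [OF that(2)]] M by (simp add: dist_pnorm)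
    then show "\<exists>M. \<forall>n\<ge>M. \<forall>n'\<ge>M. dist (?S n) (?S n') < e" by blast
  qed
  then show ?thesis by (rule Cauchy_convergent)
qed

lemma lim_scaled_eqI:
  fixes S R :: "nat \<Rightarrow> 'a"
  assumes conv: "convergent R"
    and close: "\<And>N. pnorm (S N - c * R N) \<le> B / real p ^ N"
  shows "lim S = c * lim R"
proof (rule limI)
  have R: "R \<longlonglongrightarrow> lim R" using conv by (simp add: convergent_LIMSEQ_iff)
  have bound: "(\<lambda>N. B / real p ^ N + pnorm c * dist (R N) (lim R)) \<longlonglongrightarrow> 0 + pnorm c * 0"
    by (intro tendsto_add tendsto_mult tendsto_const tendsto_divide_prime_power
        tendsto_dist_iff [THEN iffD1] R)
  have le: "dist (S N) (c * lim R) \<le> B / real p ^ N + pnorm c * dist (R N) (lim R)" for N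
  proof -
    have "dist (S N) (c * lim R) \<le> dist (S N) (c * R N) + dist (c * R N) (c * lim R)"
      by (rule dist_triangle)
    also have "dist (c * R N) (c * lim R) = pnorm c * dist (R N) (lim R)"
      by (simp only: dist_pnorm pnorm_mult right_diff_distrib [symmetric])
    finally show ?thesis using close [of N] by (simp add: dist_pnorm)
  qed
  have "(\<lambda>N. dist (S N) (c * lim R)) \<longlonglongrightarrow> 0"
    by (rule tendsto_sandwich [OF _ _ tendsto_const bound [simplified]]) (simp_all add: le)
  then show "S \<longlonglongrightarrow> c * lim R" by (rule tendsto_dist_iff [THEN iffD2])
qed

lemma pnorm_of_nat_power_shift:
  "pnorm (of_nat (a + p ^ N * j) ^ n - of_nat a ^ n :: 'a) \<le> 1 / real p ^ N"
proof -
  have "int p ^ N dvd int (a + p ^ N * j) - int a" by simp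
  also have "\<dots> dvd int (a + p ^ N * j) ^ n - int a ^ n" by (simp add: power_diff_sumr2)
  finally have "int p ^ N dvd int (a + p ^ N * j) ^ n - int a ^ n" .
  from pnorm_of_int_le_power [OF this] show ?thesis by simp
qed

lemma lipschitz_power: "lipschitz (\<lambda>a. of_nat a ^ n)"
  unfolding lipschitz_def using pnorm_of_nat_power_shift by blast

text \<open>
  Extending \<open>x\<^sup>s\<close> by 0 from the units keeps the Lipschitz bound, because a unit and a
  non-unit are at distance 1. Integrals over the units thereby become integrals over all of
  \<open>\<int>\<^sub>p\<close>. For negative \<open>s\<close> the bound survives since inversion is an isometry on units.
\<close>

lemma lipschitz_unit_powi: "lipschitz (\<lambda>a. if p dvd a then 0 else of_nat a powi s)"
  unfolding lipschitz_def
proof (intro allI)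
  fix a j N
  let ?b = "a + p ^ N * j" and ?g = "\<lambda>a. if p dvd a then 0 else of_nat a powi s :: 'a"
  have unit: "pnorm (of_nat a ^ n :: 'a) = 1" if "\<not> p dvd a" for a n
    using that by (simp add: pnorm_power pnorm_of_nat_unit)
  have unit_i: "pnorm (of_nat a powi s :: 'a) = 1" if "\<not> p dvd a" for a
    using that by (simp add: power_int_def pnorm_power pnorm_inverse pnorm_of_nat_unit)
  show "pnorm (?g ?b - ?g a) \<le> 1 / real p ^ N"
  proof (cases "p dvd ?b \<longleftrightarrow> p dvd a")
    case False
    \<comment> \<open>Adding a multiple of \<open>p\<^sup>N\<close> with \<open>N > 0\<close> preserves divisibility by \<open>p\<close>.\<close>
    then have "N = 0" by (cases N) (auto simp: dvd_add_left_iff)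
    moreover have "pnorm (?g x) \<le> 1" for x using unit_i by simp
    ultimately show ?thesis by (metis pnorm_diff_leI div_by_1 power_0)
  next
    case same: True
    show ?thesis
    proof (cases "p dvd a")
      case True
      then show ?thesis using same by simp
    next
      case a: False
      then have b: "\<not> p dvd ?b" using same by simp
      have nz: "(of_nat a :: 'a) \<noteq> 0" "(of_nat ?b :: 'a) \<noteq> 0"
        using unit [OF a, of 1] unit [OF b, of 1] by (metis pnorm_0 power_one_right zero_neq_one)+
      show ?thesis
      proof (cases "s \<ge> 0")
        case True
        then show ?thesis using a b pnorm_of_nat_power_shift [of a N j "nat s"]
          by (simp add: power_int_def del: of_nat_add)
      next
        case False
        define n where "n = nat (- s)"
        have "?g ?b - ?g a = (of_nat a ^ n - of_nat ?b ^ n) / (of_nat ?b ^ n * of_nat a ^ n)"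
          using a b False nz by (simp add: power_int_def n_def divide_simps del: of_nat_add)
        then show ?thesis
          using pnorm_of_nat_power_shift [of a N j n]
          by (simp add: pnorm_divide pnorm_mult unit a b pnorm_minus_commute del: of_nat_add)
      qed
    qed
  qed
qed

lemma lipschitz_bounded:
  assumes g: "lipschitz g" and "pnorm (g 0) \<le> 1"
  shows "pnorm (g a) \<le> 1"
proof -
  have "pnorm (g (0 + p ^ 0 * a) - g 0) \<le> 1 / real p ^ 0"
    using g unfolding lipschitz_def by blast
  with assms(2) show ?thesis using pnorm_add_leI [of "g a - g 0" 1 "g 0"] by simp
qed

section \<open>Comparing the measures\<close>

text \<open>
  The equation with index \<open>i\<close> expresses \<open>(y - 1) e\<^sub>i\<close> through the \<open>e\<^sub>m\<close> with \<open>m > i\<close>. Solving from the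
  top down, the values vanish above \<open>n\<close>. Below \<open>n\<close> each is an integral combination of
  later ones times \<open>y / (y - 1)\<close>, and this factor has norm at most 1.
\<close>

lemma shift_recurrence_bounds:
  fixes e :: "nat \<Rightarrow> 'a"
  assumes y: "pnorm (y - 1) \<ge> 1"
    and e: "\<And>m. m > d \<Longrightarrow> e m = 0"
    and rec: "\<And>i. y * (\<Sum>m\<le>d. of_nat (m choose i) * e m) = e i + (if i = n then c else 0)"
  shows "i > n \<Longrightarrow> e i = 0" and "e n = c / (y - 1)" and "pnorm (e i) \<le> pnorm c / pnorm (y - 1)"
proof -
  have y1: "y \<noteq> 1" using y by auto
  have solve: "(y - 1) * e i =
      (if i = n then c else 0) - y * (\<Sum>m\<in>{i<..d}. of_nat (m choose i) * e m)" for i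
  proof -
    have "(\<Sum>m\<le>d. of_nat (m choose i) * e m) = (\<Sum>m\<in>{i..max i d}. of_nat (m choose i) * e m)"
      by (rule sum.mono_neutral_cong) (auto simp: e not_le)
    also have "{i..max i d} = insert i {i<..max i d}" by auto
    also have "(\<Sum>m\<in>\<dots>. of_nat (m choose i) * e m) =
        e i + (\<Sum>m\<in>{i<..max i d}. of_nat (m choose i) * e m)" by simp
    also have "{i<..max i d} = {i<..d}" by auto
    finally show ?thesis using rec [of i] by (simp add: algebra_simps)
  qed
  have zero: "e i = 0" if "i > n" for i
    using that
  proof (induction "d - i" arbitrary: i rule: less_induct)
    case less
    have "e m = 0" if "m \<in> {i<..d}" for m
      using that less.prems by (intro less.hyps) auto
    then have "(y - 1) * e i = 0" using solve [of i] less.prems by simp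
    then show ?case using y1 by simp
  qed
  then show "i > n \<Longrightarrow> e i = 0" .
  have "(y - 1) * e n = c" using solve [of n] zero by simp
  then show "e n = c / (y - 1)" using y1 by (simp add: field_simps)
  have ratio: "pnorm y / pnorm (y - 1) \<le> 1"
    using pnorm_le_pnorm_minus_1 [OF y] y by (simp add: divide_simps)
  show "pnorm (e i) \<le> pnorm c / pnorm (y - 1)"
  proof (induction "d - i" arbitrary: i rule: less_induct)
    case less
    let ?B = "pnorm c / pnorm (y - 1)" and ?R = "\<Sum>m\<in>{i<..d}. of_nat (m choose i) * e m"
    have R: "pnorm ?R \<le> ?B"
    proof (rule pnorm_sum_leI)
      fix m assume "m \<in> {i<..d}"
      then have "pnorm (e m) \<le> ?B" by (intro less.hyps) auto
      then have "pnorm (of_nat (m choose i) * e m) \<le> 1 * ?B"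
        unfolding pnorm_mult by (intro mult_mono pnorm_of_nat_le_1) auto
      then show "pnorm (of_nat (m choose i) * e m) \<le> ?B" by simp
    qed simp
    have "e i = ((y - 1) * e i) / (y - 1)" using y1 by simp
    also have "\<dots> = (if i = n then c else 0) / (y - 1) - y * ?R / (y - 1)"
      by (simp only: solve diff_divide_distrib)
    also have "pnorm \<dots> \<le> ?B"
    proof (rule pnorm_diff_leI)
      have "pnorm (y * ?R / (y - 1)) = pnorm y / pnorm (y - 1) * pnorm ?R"
        by (simp add: pnorm_mult pnorm_divide)
      also have "\<dots> \<le> 1 * ?B" using ratio R by (intro mult_mono) auto
      finally show "pnorm (y * ?R / (y - 1)) \<le> ?B" by simp
    qed (simp add: pnorm_divide divide_nonneg_nonneg)
    finally show ?case .
  qed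
qed

text \<open>
  For \<open>w = z\<close> this is the measure \<open>\<mu>\<^sub>1\<close> of the disc around \<open>a\<close> of radius \<open>p^(-N)\<close>, divided by
  \<open>h(1)\<close>. It is additive because summing over the \<open>p\<close> subdiscs is summing a geometric progression.
\<close>

definition cyclic_weight :: "'a \<Rightarrow> nat \<Rightarrow> nat \<Rightarrow> 'a" where
  "cyclic_weight w N a = w ^ a / (w ^ (p ^ N) - 1)"

lemma cyclic_weight_additive:
  assumes w: "pnorm (w - 1) \<ge> 1"
  shows "cyclic_weight w N a = (\<Sum>j<p. cyclic_weight w (Suc N) (a + p ^ N * j))"
proof -
  have nz: "w ^ (p ^ N) \<noteq> 1" for N
    using pnorm_prime_power_power_minus_1_ge [OF w, of N] by auto
  have "(\<Sum>j<p. cyclic_weight w (Suc N) (a + p ^ N * j)) =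
      cyclic_weight w (Suc N) a * (\<Sum>j<p. (w ^ (p ^ N)) ^ j)"
    by (simp add: cyclic_weight_def sum_distrib_left power_add power_mult)
  also have "(\<Sum>j<p. (w ^ (p ^ N)) ^ j) = (w ^ (p ^ Suc N) - 1) / (w ^ (p ^ N) - 1)"
    by (subst geometric_sum [OF nz]) (simp add: mult.commute flip: power_mult)
  finally show ?thesis
    using nz [of "Suc N"] by (simp add: cyclic_weight_def)
qed

lemma cyclic_weight_bounded:
  assumes w: "pnorm (w - 1) \<ge> 1" and a: "a \<le> p ^ N"
  shows "pnorm (cyclic_weight w N a) \<le> 1"
proof -
  have "pnorm (w ^ a) \<le> pnorm (w ^ (p ^ N) - 1)"
    by (rule pnorm_power_le_prime_power_minus_1 [OF w a])
  moreover have "pnorm (w ^ (p ^ N) - 1) > 0"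
    using pnorm_prime_power_power_minus_1_ge [OF w, of N] by linarith
  ultimately show ?thesis by (simp add: cyclic_weight_def pnorm_divide)
qed

text \<open>
  Multiplying by \<open>p^(N n)\<close> clears the denominators of \<open>(a/p\<^sup>N)\<^sup>i\<close> and leaves a factor
  \<open>p^(N (n - i))\<close>, which is at most \<open>p^(-N)\<close> in norm except in the top term \<open>i = n\<close>. The factor
  \<open>w\<^sup>a\<close> cannot spoil this: it is bounded by \<open>|y - 1|\<close>, which the bound on the coefficients cancels.
\<close>

lemma distribution_leading_term:
  fixes w :: 'a
  assumes w: "pnorm (w - 1) \<ge> 1" and a: "a < p ^ N"
    and eq: "smult (to_fract [:0, 1:]) (F \<circ>\<^sub>p [:1, 1:]) - F = monom (to_fract [:c:]) n"
    and defd: "xpoly_defined F (of_nat a / of_nat p ^ N) (w ^ (p ^ N))"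
  shows "pnorm (of_nat p ^ (N * n) * w ^ a * xpoly_eval F (of_nat a / of_nat p ^ N) (w ^ (p ^ N))
             - of_rat c * (of_nat a ^ n * cyclic_weight w N a))
           \<le> pnorm (of_rat c :: 'a) / real p ^ N"
proof -
  define y where "y = w ^ (p ^ N)"
  define e where "e i = ratfun_eval (coeff F i) y" for i
  define q :: 'a where "q = of_nat p ^ N"
  have q: "q \<noteq> 0" using prime_p by (auto simp: q_def)
  have y: "pnorm (y - 1) \<ge> 1"
    unfolding y_def by (rule pnorm_prime_power_power_minus_1_ge [OF w])
  have wy: "pnorm (w ^ a) \<le> pnorm (y - 1)"
    unfolding y_def using w a by (intro pnorm_power_le_prime_power_minus_1) auto
  have big: "e m = 0" if "m > degree F" for m
    using that by (simp add: e_def coeff_eq_0)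
  have rec: "y * (\<Sum>m\<le>degree F. of_nat (m choose i) * e m) =
      e i + (if i = n then of_rat c else 0)" for i
    unfolding e_def using xpoly_eval_coeff_recurrence [OF eq _ order_refl, of _ y] defd
    by (simp add: y_def)
  note bounds = shift_recurrence_bounds [OF y big rec]
  let ?P = "map_poly (\<lambda>c. ratfun_eval c y) F"
  have P: "coeff ?P i = e i" for i by (simp add: coeff_map_poly e_def)
  have "degree ?P \<le> n" by (rule degree_le) (simp add: P bounds(1))
  then have "xpoly_eval F (of_nat a / q) y = (\<Sum>i\<le>n. e i * (of_nat a / q) ^ i)"
    unfolding xpoly_eval_def
    by (subst poly_as_sum_of_monoms' [symmetric]) (simp_all add: P poly_sum poly_monom)
  then have "q ^ n * xpoly_eval F (of_nat a / q) y = (\<Sum>i\<le>n. q ^ n * (e i * (of_nat a / q) ^ i))"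
    by (simp only: sum_distrib_left)
  also have "\<dots> = (\<Sum>i\<le>n. e i * of_nat a ^ i * q ^ (n - i))"
    using q by (intro sum.cong refl) (simp add: power_diff power_divide)
  also have "\<dots> = (\<Sum>i<n. e i * of_nat a ^ i * q ^ (n - i)) + e n * of_nat a ^ n"
    by (simp flip: lessThan_Suc_atMost)
  finally have main: "q ^ n * xpoly_eval F (of_nat a / q) y =
      (\<Sum>i<n. e i * of_nat a ^ i * q ^ (n - i)) + of_rat c / (y - 1) * of_nat a ^ n"
    by (simp add: bounds(2))
  have "of_nat p ^ (N * n) * w ^ a * xpoly_eval F (of_nat a / q) y
      - of_rat c * (of_nat a ^ n * (w ^ a / (y - 1))) =
      w ^ a * (q ^ n * xpoly_eval F (of_nat a / q) y) - of_rat c * (of_nat a ^ n * (w ^ a / (y - 1)))"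
    by (simp add: q_def power_mult)
  also have "\<dots> = w ^ a * (\<Sum>i<n. e i * of_nat a ^ i * q ^ (n - i))"
    unfolding main by (simp add: algebra_simps)
  also have "\<dots> = (\<Sum>i<n. w ^ a * (e i * of_nat a ^ i * q ^ (n - i)))"
    by (rule sum_distrib_left)
  also have "pnorm \<dots> \<le> pnorm (of_rat c :: 'a) / real p ^ N"
  proof (rule pnorm_sum_leI)
    fix i assume i: "i \<in> {..<n}"
    have "pnorm (q ^ (n - i)) \<le> 1 / real p ^ N"
    proof -
      have "q ^ (n - i) = of_int (int p ^ (N * (n - i)))" by (simp add: q_def power_mult)
      moreover have "N \<le> N * (n - i)" using i by (cases "n - i") auto
      then have "int p ^ N dvd int p ^ (N * (n - i))" by (rule le_imp_power_dvd)
      ultimately show ?thesis using pnorm_of_int_le_power by metis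
    qed
    moreover have "pnorm (of_nat a ^ i :: 'a) \<le> 1"
      unfolding pnorm_power by (intro power_le_one pnorm_of_nat_le_1) simp
    ultimately have "pnorm (w ^ a * (e i * of_nat a ^ i * q ^ (n - i))) \<le>
        pnorm (y - 1) * (pnorm (of_rat c :: 'a) / pnorm (y - 1) * 1 * (1 / real p ^ N))"
      unfolding pnorm_mult using wy bounds(3) by (intro mult_mono) auto
    then show "pnorm (w ^ a * (e i * of_nat a ^ i * q ^ (n - i)))
        \<le> pnorm (of_rat c :: 'a) / real p ^ N"
      using y by (auto split: if_splits)
  qed simp
  finally show ?thesis by (simp add: y_def q_def cyclic_weight_def)
qed

text \<open>
  The difference equation thus determines the integrals up to the factor \<open>c\<close>: the limit on the
  right does not depend on \<open>F\<close>.
\<close>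

lemma lim_riemann_sums_distribution:
  fixes w :: 'a and M :: "nat \<Rightarrow> nat \<Rightarrow> 'a"
  assumes w: "pnorm (w - 1) \<ge> 1"
    and eq: "smult (to_fract [:0, 1:]) (F \<circ>\<^sub>p [:1, 1:]) - F = monom (to_fract [:c:]) n"
    and defd: "\<And>N a. a < p ^ N \<Longrightarrow> xpoly_defined F (of_nat a / of_nat p ^ N) (w ^ (p ^ N))"
    and M: "\<And>N a. a < p ^ N \<Longrightarrow> M N a =
        of_nat p ^ (N * n) * w ^ a * xpoly_eval F (of_nat a / of_nat p ^ N) (w ^ (p ^ N))"
    and bounded: "\<And>a. pnorm (g a) \<le> 1"
    and lip: "lipschitz (\<lambda>a. g a * of_nat a ^ n)"
  shows "lim (\<lambda>N. \<Sum>a<p ^ N. g a * M N a) =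
    of_rat c * lim (\<lambda>N. \<Sum>a<p ^ N. g a * of_nat a ^ n * cyclic_weight w N a)"
proof (rule lim_scaled_eqI)
  show "convergent (\<lambda>N. \<Sum>a<p ^ N. g a * of_nat a ^ n * cyclic_weight w N a)"
    by (rule riemann_sums_converge [OF lip cyclic_weight_additive [OF w]
          cyclic_weight_bounded [OF w less_imp_le]])
  fix N
  let ?C = "pnorm (of_rat c :: 'a) / real p ^ N"
  have "(\<Sum>a<p ^ N. g a * M N a) -
      of_rat c * (\<Sum>a<p ^ N. g a * of_nat a ^ n * cyclic_weight w N a) =
      (\<Sum>a<p ^ N. g a * (M N a - of_rat c * (of_nat a ^ n * cyclic_weight w N a)))"
    by (simp add: sum_distrib_left sum_subtractf algebra_simps)
  also have "pnorm \<dots> \<le> ?C"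
  proof (rule pnorm_sum_leI)
    fix a assume "a \<in> {..<p ^ N}"
    then have a: "a < p ^ N" by simp
    have "pnorm (M N a - of_rat c * (of_nat a ^ n * cyclic_weight w N a)) \<le> ?C"
      unfolding M [OF a] by (rule distribution_leading_term [OF w a eq defd [OF a]])
    then have "pnorm (g a * (M N a - of_rat c * (of_nat a ^ n * cyclic_weight w N a))) \<le> 1 * ?C"
      unfolding pnorm_mult by (intro mult_mono bounded) auto
    then show "pnorm (g a * (M N a - of_rat c * (of_nat a ^ n * cyclic_weight w N a))) \<le> ?C"
      by simp
  qed simp
  finally show "pnorm ((\<Sum>a<p ^ N. g a * M N a) -
      of_rat c * (\<Sum>a<p ^ N. g a * of_nat a ^ n * cyclic_weight w N a)) \<le> ?C" .
qed

end

theorem proposition2: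
  fixes p :: nat
    and f :: "nat \<Rightarrow> rat poly fract poly"
    and h :: "nat \<Rightarrow> rat"
    and \<mu> :: "nat \<Rightarrow> 'a::{field_char_0, complete_space} \<Rightarrow> 'a set \<Rightarrow> 'a"
    and z :: 'a
    and k :: nat
    and r :: int
  assumes "prime p"
    and "padic_complex_field p TYPE('a)"
    and "\<And>j w N a. j \<ge> 1 \<Longrightarrow> pnorm (w - 1 :: 'a) \<ge> 1 \<Longrightarrow> a < p ^ N \<Longrightarrow>
           xpoly_defined (f j) (of_nat a / of_nat p ^ N) (w ^ (p ^ N))"
    and "\<And>j w. j \<ge> 1 \<Longrightarrow> pnorm (w - 1) \<ge> 1 \<Longrightarrow> padic_distribution (\<mu> j w)"
    and "\<And>j w N a. j \<ge> 1 \<Longrightarrow> pnorm (w - 1) \<ge> 1 \<Longrightarrow> a < p ^ N \<Longrightarrow>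
           \<mu> j w (padic_disc p a N) =
             of_nat p ^ (N * (j - 1)) * w ^ a *
               xpoly_eval (f j) (of_nat a / of_nat p ^ N) (w ^ (p ^ N))"
    and "\<And>j n. j \<ge> 1 \<Longrightarrow> xpoly_defined ((pderiv ^^ n) (f j)) (0 :: 'a) 0"
    and "\<And>j. j \<ge> 1 \<Longrightarrow>
           smult (to_fract [:0, 1:]) (f j \<circ>\<^sub>p [:1, 1:]) - f j =
             monom (to_fract [:h j:]) (j - 1)"
    and "h 1 \<noteq> 0"
    and "pnorm (z - 1) \<ge> 1"
    and "k \<ge> 1"
  shows "(r \<ge> 0 \<longrightarrow>
            padic_integral p (\<mu> k z) (\<lambda>x. x powi r) =
              of_rat (h k / h 1) *
                padic_integral p (\<mu> 1 z) (\<lambda>x. x powi (r + int k - 1))) \<and>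
         padic_unit_integral p (\<mu> k z) (\<lambda>x. x powi r) =
           of_rat (h k / h 1) *
             padic_unit_integral p (\<mu> 1 z) (\<lambda>x. x powi (r + int k - 1))"
proof -
  have field: "padic_complex_field p TYPE('a)" by fact
  interpret padic_norm p "TYPE('a)"
    using \<open>prime p\<close> field by unfold_locales (auto simp: padic_complex_field_def)
  define I where "I s = lim (\<lambda>N. \<Sum>a<p ^ N. of_nat a powi s * cyclic_weight z N a)" for s
  define U where "U s = lim (\<lambda>N. \<Sum>a<p ^ N.
      (if p dvd a then 0 else of_nat a powi s) * cyclic_weight z N a)" for s
  have common: "lim (\<lambda>N. \<Sum>a<p ^ N. g a * \<mu> j z (padic_disc p a N)) =
      of_rat (h j) * lim (\<lambda>N. \<Sum>a<p ^ N. g a * of_nat a ^ (j - 1) * cyclic_weight z N a)"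
    if "j \<ge> 1" "\<And>a. pnorm (g a) \<le> 1" "lipschitz (\<lambda>a. g a * of_nat a ^ (j - 1))" for g j
    using that assms(3) [of j z] assms(5) [of j z] assms(7) [of j] assms(9)
    by (intro lim_riemann_sums_distribution [where F = "f j"]) auto
  have int: "padic_integral p (\<mu> j z) (\<lambda>x. x powi s) = of_rat (h j) * I (s + int j - 1)"
    if "j \<ge> 1" "s \<ge> 0" for j s
  proof -
    have nonneg: "of_nat a powi s = (of_nat a ^ nat s :: 'a)" for a
      using that by (simp add: power_int_def)
    have "s + int j - 1 = int (nat s + (j - 1))" using that by linarith
    then have shift: "of_nat a powi s * of_nat a ^ (j - 1) = (of_nat a powi (s + int j - 1) :: 'a)" for a
      by (simp only: nonneg power_int_of_nat power_add)
    have lip: "lipschitz (\<lambda>a. of_nat a powi s * of_nat a ^ (j - 1))"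
      unfolding nonneg power_add [symmetric] by (rule lipschitz_power)
    have "pnorm (of_nat a powi s :: 'a) \<le> 1" for a
      unfolding nonneg pnorm_power by (intro power_le_one pnorm_of_nat_le_1) simp
    from common [OF that(1) this lip] show ?thesis
      by (simp only: padic_integral_def I_def shift)
  qed
  have unit: "padic_unit_integral p (\<mu> j z) (\<lambda>x. x powi s) = of_rat (h j) * U (s + int j - 1)"
    if "j \<ge> 1" for j s
  proof -
    let ?g = "\<lambda>s a. if p dvd a then 0 else of_nat a powi s :: 'a"
    have shift: "?g s a * of_nat a ^ (j - 1) = ?g (s + int j - 1) a" for a
    proof (cases "p dvd a")
      case False
      then have "a \<noteq> 0" by (intro notI) simp
      then have nz: "(of_nat a :: 'a) \<noteq> 0" by simp
      have "of_nat a powi (s + int (j - 1)) = (of_nat a powi s * of_nat a ^ (j - 1) :: 'a)"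
        using power_int_add [OF disjI1 [OF nz]] by (simp only: power_int_of_nat)
      moreover have "s + int (j - 1) = s + int j - 1" using that by linarith
      ultimately show ?thesis using False by (simp only: if_False)
    qed simp
    have lip: "lipschitz (\<lambda>a. ?g s a * of_nat a ^ (j - 1))"
      unfolding shift by (rule lipschitz_unit_powi)
    have "pnorm (?g s a) \<le> 1" for a
      by (rule lipschitz_bounded [OF lipschitz_unit_powi]) simp
    from common [OF that this lip]
    have "lim (\<lambda>N. \<Sum>a<p ^ N. ?g s a * \<mu> j z (padic_disc p a N)) = of_rat (h j) * U (s + int j - 1)"
      by (simp only: U_def shift)
    moreover have "(\<Sum>a | a < p ^ N \<and> \<not> p dvd a. of_nat a powi s * \<mu> j z (padic_disc p a N)) =
        (\<Sum>a<p ^ N. ?g s a * \<mu> j z (padic_disc p a N))" for N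
      by (rule sum.mono_neutral_cong_left) auto
    ultimately show ?thesis by (simp add: padic_unit_integral_def)
  qed
  have "(of_rat (h 1) :: 'a) \<noteq> 0" using \<open>h 1 \<noteq> 0\<close> by simp
  then have cancel: "of_rat (h k / h 1) * (of_rat (h 1) * x) = of_rat (h k) * x" for x :: 'a
    by (simp add: of_rat_divide)
  show ?thesis
  proof (intro conjI impI)
    assume "r \<ge> 0"
    then have "padic_integral p (\<mu> 1 z) (\<lambda>x. x powi (r + int k - 1)) =
        of_rat (h 1) * I (r + int k - 1)"
      using int [of 1 "r + int k - 1"] \<open>k \<ge> 1\<close> by simp
    with int [OF \<open>k \<ge> 1\<close> \<open>r \<ge> 0\<close>]
    show "padic_integral p (\<mu> k z) (\<lambda>x. x powi r) =
        of_rat (h k / h 1) * padic_integral p (\<mu> 1 z) (\<lambda>x. x powi (r + int k - 1))"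
      by (simp only: cancel)
  next
    have "padic_unit_integral p (\<mu> 1 z) (\<lambda>x. x powi (r + int k - 1)) =
        of_rat (h 1) * U (r + int k - 1)"
      using unit [of 1 "r + int k - 1"] by simp
    with unit [OF \<open>k \<ge> 1\<close>]
    show "padic_unit_integral p (\<mu> k z) (\<lambda>x. x powi r) =
        of_rat (h k / h 1) * padic_unit_integral p (\<mu> 1 z) (\<lambda>x. x powi (r + int k - 1))"
      by (simp only: cancel)
  qed
qed

end
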